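(* Let $n,k,r$ be positive integers with $n\ge r\ge 2$ (and $n \ge 2$ in the graph case), and assume in each item that the number of colors is at most the number of edges (i.e. at most $\binom n2$ in items 1--3 and at most $\binom nr$ in items 4--5). 1. $f(n,n-1)=\lfloor n/2\rfloor$. 2. $f(n,n)=\lfloor (n-1)/2\rfloor$. 3. If $k\ge n-1$ and $k$ divides $\binom{n}{2}$, then $f(n,k)=\frac{n(n-1)}{2k}$. 4. Suppose $t\ge 1$ is an integer and $rt$ divides $n$. Then for $k=\frac{t\,(n-1)!}{(r-1)!\,(n-r)!}$ we have $f(n,k,r)=\frac{n}{rt}$. 5. If $k\ge \binom{n}{r}-\binom{n-r}{r}$, then $f(n,k,r)=\left\lfloor \binom{n}{r}/k\right\rfloor$.
   Context: $K_n^r$ denotes the complete $r$-uniform hypergraph on $n$ vertices (all $r$-subsets of the vertex set are edges), and $K_n=K_n^2$. For a $k$-edge coloring $c:E(K_n^r)\to\{1,\ldots,k\}$ (an arbitrary map), let $f(K_n^r,c)$ be the minimum, over the colors $i\in\{1,\ldots,k\}$, of the number of connected components of the subhypergraph induced by the edges of color $i$; this subhypergraph consists of the edges of color $i$ and the vertices contained in them, so isolated vertices are not counted as components (an unused color has $0$ components). $f(n,k,r)$ is the maximum of $f(K_n^r,c)$ over all $k$-edge colorings $c$ of $K_n^r$, and $f(n,k)=f(n,k,2)$. As usual $\binom{a}{b}=0$ if $0\le a<b$. *)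

theory Defs
  imports Complex_Main "HOL-Library.FuncSet"
begin

text \<open>The edge set of the complete \<open>r\<close>-uniform hypergraph with vertex set \<open>{1..n}\<close>.\<close>

definition complete_hypergraph :: "nat \<Rightarrow> nat \<Rightarrow> nat set set" where
  "complete_hypergraph n r = {e. e \<subseteq> {1..n} \<and> card e = r}"

definition adjacency :: "'a set set \<Rightarrow> ('a \<times> 'a) set" where
  "adjacency E = {(u, v). \<exists>e\<in>E. u \<in> e \<and> v \<in> e}"

text \<open>The vertex sets of the connected components of the hypergraph with edge set \<open>E\<close> and
  vertex set \<open>\<Union>E\<close>, so that vertices outside every edge of \<open>E\<close> do not count.\<close>

definition components :: "'a set set \<Rightarrow> 'a set set" where
  "components E = \<Union>E // (adjacency E)\<^sup>*"

definition color_class :: "nat \<Rightarrow> nat \<Rightarrow> (nat set \<Rightarrow> nat) \<Rightarrow> nat \<Rightarrow> nat set set" where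
  "color_class n r c i = {e \<in> complete_hypergraph n r. c e = i}"

definition min_components :: "nat \<Rightarrow> nat \<Rightarrow> nat \<Rightarrow> (nat set \<Rightarrow> nat) \<Rightarrow> nat" where
  "min_components n k r c = Min ((\<lambda>i. card (components (color_class n r c i))) ` {1..k})"

text \<open>Colorings are taken to be extensional, i.e. \<open>undefined\<close> on non-edges, so that they form
  a finite set. For \<open>k = 0\<close> the value is unspecified.\<close>

definition f_hyp :: "nat \<Rightarrow> nat \<Rightarrow> nat \<Rightarrow> nat" where
  "f_hyp n k r = Max (min_components n k r ` (complete_hypergraph n r \<rightarrow>\<^sub>E {1..k}))"

abbreviation f_graph :: "nat \<Rightarrow> nat \<Rightarrow> nat" where
  "f_graph n k \<equiv> f_hyp n k 2"

end

theory Submission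
  imports Defs
begin

text \<open>
  All five items say that \<open>f(n,k,r)\<close> equals the average class size \<open>q = \<lfloor>(n choose r) / k\<rfloor>\<close>.
  It cannot be larger, because a component contains an edge, so some color has at most
  \<open>q\<close> components (\<open>min_components_le\<close>).

  For the converse, the edges are colored so that every class has \<open>q\<close> or \<open>q + 1\<close> edges, spread
  over the vertices as evenly as possible. A hypergraph with \<open>a\<close> edges of size \<open>r\<close> that cover \<open>m\<close>
  vertices has at least \<open>m - (r - 1) a\<close> components, as adding an edge merges at most \<open>r\<close> of them
  into one (\<open>card_vertices_le_components\<close>). If \<open>r a \<le> n\<close>, an evenly spread class is a matching,
  \<open>m = r a\<close>, and there are \<open>a\<close> components. If \<open>r a \<ge> n\<close>, an evenly spread class covers all vertices;
  when \<open>a = q + 1\<close> and \<open>r a = n + 1\<close> this still leaves \<open>q\<close> components. So \<open>f(n,k,r) = q\<close> as soon as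
  \<open>r q \<le> n\<close> and, unless \<open>k\<close> divides \<open>n choose r\<close>, also \<open>r (q + 1) \<le> n + 1\<close>
  (\<open>f_hyp_eq_average\<close>); the borderline \<open>n + 1\<close> is what the case of \<open>n - 1\<close> colors and odd \<open>n\<close> needs.
  The items follow by arithmetic. The only one that needs an idea is the last, where
  \<open>choose_le_blocks\<close> shows that \<open>n choose r\<close> is at most \<open>\<lfloor>n / r\<rfloor>\<close> times the number of edges
  meeting a fixed edge.

  That evenly spread colorings with prescribed class sizes exist is Baranyai's theorem
  (\<open>baranyai\<close>). Its proof distinguishes the vertices one after another: at each stage
  the vertices not yet treated are identified, and separating the next one amounts to rounding a
  real matrix with integral column sums to an integral one, keeping each row sum within given
  integral bounds (\<open>transport_rounding\<close>).
\<close>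

section \<open>Rounding matrices with integral column sums\<close>

text \<open>The integral points of a transportation polytope in which only the column sums are
  prescribed; the row sums stay free because they are adjusted by moving units between rows.\<close>
definition fillings :: "'a set \<Rightarrow> 'b set \<Rightarrow> ('a \<Rightarrow> 'b \<Rightarrow> nat) \<Rightarrow> ('b \<Rightarrow> nat) \<Rightarrow> ('a \<Rightarrow> 'b \<Rightarrow> nat) set" where
  "fillings I J m T = {y. (\<forall>i\<in>I. \<forall>j\<in>J. y i j \<le> m i j) \<and> (\<forall>j\<in>J. (\<Sum>i\<in>I. y i j) = T j)}"

text \<open>The residual graph on the rows: an edge from \<open>a\<close> to \<open>b\<close> means that some column admits
  moving one unit from row \<open>a\<close> to row \<open>b\<close>.\<close>
definition movable :: "'a set \<Rightarrow> 'b set \<Rightarrow> ('a \<Rightarrow> 'b \<Rightarrow> nat) \<Rightarrow> ('a \<Rightarrow> 'b \<Rightarrow> nat) \<Rightarrow> ('a \<times> 'a) set" where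
  "movable I J m y = {(a, b). a \<in> I \<and> b \<in> I \<and> (\<exists>j\<in>J. 0 < y a j \<and> y b j < m b j)}"

lemma bounded_nat_sum_exists:
  fixes b :: "'a \<Rightarrow> nat"
  assumes "finite I" "t \<le> sum b I"
  shows "\<exists>z. (\<forall>i\<in>I. z i \<le> b i) \<and> sum z I = t"
  using assms
proof (induction I arbitrary: t rule: finite_induct)
  case empty
  then show ?case by simp
next
  case (insert a I)
  define s where "s = min t (b a)"
  have "t - s \<le> sum b I" using insert by (auto simp: s_def)
  then obtain z where z: "\<forall>i\<in>I. z i \<le> b i" "sum z I = t - s" using insert.IH by blast
  have "sum (z(a := s)) I = sum z I" using insert.hyps by (intro sum.cong) auto
  then have "sum (z(a := s)) (insert a I) = t"
    using insert.hyps z by (simp add: s_def)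
  moreover have "\<forall>i\<in>insert a I. (z(a := s)) i \<le> b i" using z by (simp add: s_def)
  ultimately show ?case by blast
qed

lemma fillings_nonempty:
  assumes "finite I" "\<And>j. j \<in> J \<Longrightarrow> T j \<le> (\<Sum>i\<in>I. m i j)"
  shows "fillings I J m T \<noteq> {}"
proof -
  have "\<forall>j\<in>J. \<exists>z. (\<forall>i\<in>I. z i \<le> m i j) \<and> sum z I = T j"
    using assms by (intro ballI bounded_nat_sum_exists) auto
  then obtain Z where "\<forall>j\<in>J. (\<forall>i\<in>I. Z j i \<le> m i j) \<and> sum (Z j) I = T j" by metis
  then have "(\<lambda>i j. Z j i) \<in> fillings I J m T" by (simp add: fillings_def)
  then show ?thesis by blast
qed

text \<open>The last conclusion lets moves be chained: taking a unit from row \<open>a\<close> can only spoil residual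
  edges that leave \<open>a\<close>, and giving it to row \<open>b\<close> only those that enter \<open>b\<close>.\<close>
lemma move_unit:
  assumes fin: "finite I" "finite J" and y: "y \<in> fillings I J m T"
    and ab: "(a, b) \<in> movable I J m y" "a \<noteq> b"
  obtains y' where "y' \<in> fillings I J m T"
    "\<forall>i\<in>I. (\<Sum>j\<in>J. y' i j) + of_bool (i = a) = (\<Sum>j\<in>J. y i j) + of_bool (i = b)"
    "\<And>u v. (u, v) \<in> movable I J m y \<Longrightarrow> u \<noteq> a \<Longrightarrow> v \<notin> {a, b} \<Longrightarrow> (u, v) \<in> movable I J m y'"
proof -
  obtain j where j: "a \<in> I" "b \<in> I" "j \<in> J" "0 < y a j" "y b j < m b j"
    using ab by (auto simp: movable_def)
  define y' where "y' = (\<lambda>i l. if l = j \<and> i = a then y i l - 1 else if l = j \<and> i = b then y i l + 1 else y i l)"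
  have eq: "y' i l + of_bool (l = j \<and> i = a) = y i l + of_bool (l = j \<and> i = b)" for i l
    using j ab(2) by (auto simp: y'_def)
  have col: "(\<Sum>i\<in>I. y' i l) = (\<Sum>i\<in>I. y i l)" for l
  proof -
    have "(\<Sum>i\<in>I. y' i l + of_bool (l = j \<and> i = a)) = (\<Sum>i\<in>I. y i l + of_bool (l = j \<and> i = b))"
      by (simp only: eq)
    then show ?thesis using fin j by (cases "l = j") (simp_all add: sum.distrib of_bool_def)
  qed
  have row: "(\<Sum>l\<in>J. y' i l) + of_bool (i = a) = (\<Sum>l\<in>J. y i l) + of_bool (i = b)" for i
  proof -
    have "(\<Sum>l\<in>J. y' i l + of_bool (l = j \<and> i = a)) = (\<Sum>l\<in>J. y i l + of_bool (l = j \<and> i = b))"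
      by (simp only: eq)
    then show ?thesis using fin j by (cases "i = a"; cases "i = b") (simp_all add: sum.distrib of_bool_def)
  qed
  have "y' i l \<le> m i l" if "i \<in> I" "l \<in> J" for i l
    using y j that by (fastforce simp: y'_def fillings_def)
  then have "y' \<in> fillings I J m T" using y col by (auto simp: fillings_def)
  moreover have "(u, v) \<in> movable I J m y'"
    if "(u, v) \<in> movable I J m y" "u \<noteq> a" "v \<notin> {a, b}" for u v
  proof -
    obtain l where l: "u \<in> I" "v \<in> I" "l \<in> J" "0 < y u l" "y v l < m v l"
      using \<open>(u, v) \<in> movable I J m y\<close> by (auto simp: movable_def)
    then have "0 < y' u l" "y' v l < m v l" using that by (auto simp: y'_def)
    then show ?thesis using l by (auto simp: movable_def)
  qed
  ultimately show ?thesis using that row by blast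
qed

lemma rtrancl_distinct_path:
  assumes "(a, b) \<in> R\<^sup>*"
  shows "\<exists>p. p \<noteq> [] \<and> distinct p \<and> successively (\<lambda>u v. (u, v) \<in> R) p \<and> hd p = a \<and> last p = b"
  using assms
proof (induction rule: rtrancl_induct)
  case base
  show ?case by (rule exI[of _ "[a]"]) simp
next
  case (step b c)
  then obtain p where p: "p \<noteq> []" "distinct p" "successively (\<lambda>u v. (u, v) \<in> R) p"
    "hd p = a" "last p = b" by blast
  show ?case
  proof (cases "c \<in> set p")
    case True
    then obtain p1 p2 where "p = p1 @ c # p2" by (meson split_list)
    then have "p = (p1 @ [c]) @ p2" by simp
    then show ?thesis using p
      by (intro exI[of _ "p1 @ [c]"]) (auto simp: successively_append_iff hd_append split: if_splits)
  next
    case False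
    then show ?thesis using p step
      by (intro exI[of _ "p @ [c]"]) (auto simp: successively_append_iff)
  qed
qed

text \<open>Distinctness of the path keeps its later edges usable: after the first move from \<open>a\<close> to \<open>b\<close>,
  the rest of the path never returns to \<open>a\<close> and never enters \<open>b\<close> again.\<close>
lemma move_unit_along_path:
  assumes fin: "finite I" "finite J" and "y \<in> fillings I J m T"
    and "p \<noteq> []" "distinct p" "successively (\<lambda>u v. (u, v) \<in> movable I J m y) p"
  shows "\<exists>y'\<in>fillings I J m T. \<forall>i\<in>I.
    (\<Sum>j\<in>J. y' i j) + of_bool (i = hd p) = (\<Sum>j\<in>J. y i j) + of_bool (i = last p)"
  using assms(3-)
proof (induction p arbitrary: y)
  case (Cons a p)
  show ?case
  proof (cases p)
    case Nil
    then show ?thesis using Cons.prems by auto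
  next
    case (Cons b q)
    have ab: "(a, b) \<in> movable I J m y" "a \<noteq> b" using Cons.prems Cons by auto
    obtain y1 where y1: "y1 \<in> fillings I J m T"
      "\<forall>i\<in>I. (\<Sum>j\<in>J. y1 i j) + of_bool (i = a) = (\<Sum>j\<in>J. y i j) + of_bool (i = b)"
      "\<And>u v. (u, v) \<in> movable I J m y \<Longrightarrow> u \<noteq> a \<Longrightarrow> v \<notin> {a, b} \<Longrightarrow> (u, v) \<in> movable I J m y1"
      using move_unit[OF fin Cons.prems(1) ab] by blast
    have nth: "p ! i \<noteq> a" "p ! Suc i \<notin> {a, b}" if "Suc i < length p" for i
      using that Cons.prems(3) Cons nth_mem[of i p] nth_mem[of "Suc i" p]
      by (auto simp: nth_eq_iff_index_eq)
    have "successively (\<lambda>u v. (u, v) \<in> movable I J m y) p"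
      using Cons.prems(4) Cons by simp
    then have "successively (\<lambda>u v. (u, v) \<in> movable I J m y1) p"
      using y1(3) nth by (auto simp: successively_conv_nth)
    then obtain y' where y': "y' \<in> fillings I J m T"
      "\<forall>i\<in>I. (\<Sum>j\<in>J. y' i j) + of_bool (i = hd p) = (\<Sum>j\<in>J. y1 i j) + of_bool (i = last p)"
      using Cons.IH[OF y1(1)] Cons.prems Cons by auto
    have "(\<Sum>j\<in>J. y' i j) + of_bool (i = hd (a # p)) = (\<Sum>j\<in>J. y i j) + of_bool (i = last (a # p))"
      if "i \<in> I" for i
    proof -
      have "hd p = b" "last (a # p) = last p" using Cons by auto
      then show ?thesis
        using that y'(2)[rule_format, OF that] y1(2)[rule_format, OF that] by simp
    qed
    then show ?thesis using y'(1) by blast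
  qed
qed simp

text \<open>The cut estimate. If no residual edge leaves \<open>A\<close>, each column either is zero on the rows in
  \<open>A\<close> or is filled to capacity on the rows outside \<open>A\<close>. In both cases no real filling with the
  same column sum can put less of that column into \<open>A\<close>.\<close>
lemma closed_rows_sum_le:
  fixes x :: "'a \<Rightarrow> 'b \<Rightarrow> real"
  assumes fin: "finite I" "finite J" and y: "y \<in> fillings I J m T"
    and x: "\<And>i j. i \<in> I \<Longrightarrow> j \<in> J \<Longrightarrow> 0 \<le> x i j \<and> x i j \<le> real (m i j)"
    and colx: "\<And>j. j \<in> J \<Longrightarrow> (\<Sum>i\<in>I. x i j) = real (T j)"
    and A: "A \<subseteq> I" "\<And>a b. a \<in> A \<Longrightarrow> (a, b) \<in> movable I J m y \<Longrightarrow> b \<in> A"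
  shows "(\<Sum>i\<in>A. \<Sum>j\<in>J. real (y i j)) \<le> (\<Sum>i\<in>A. \<Sum>j\<in>J. x i j)"
proof -
  have "(\<Sum>i\<in>A. real (y i j)) \<le> (\<Sum>i\<in>A. x i j)" if j: "j \<in> J" for j
  proof (cases "\<forall>i\<in>A. y i j = 0")
    case True
    then show ?thesis using x j A(1) by (auto intro!: sum_nonneg)
  next
    case False
    then obtain a where a: "a \<in> A" "0 < y a j" by auto
    have full: "m b j \<le> y b j" if "b \<in> I - A" for b
    proof (rule ccontr)
      assume "\<not> m b j \<le> y b j"
      then have "(a, b) \<in> movable I J m y" using a A(1) j that by (auto simp: movable_def)
      then show False using A(2)[OF a(1)] that by blast
    qed
    have "(\<Sum>i\<in>I - A. x i j) \<le> (\<Sum>i\<in>I - A. real (y i j))"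
    proof (rule sum_mono)
      fix b assume b: "b \<in> I - A"
      have "x b j \<le> real (m b j)" using x b j by blast
      also have "\<dots> \<le> real (y b j)" using full[OF b] by simp
      finally show "x b j \<le> real (y b j)" .
    qed
    moreover have "(\<Sum>i\<in>I. real (y i j)) = (\<Sum>i\<in>I. x i j)"
      using y colx[OF j] j unfolding fillings_def by (simp flip: of_nat_sum)
    ultimately show ?thesis
      using sum.subset_diff[OF A(1) fin(1), of "\<lambda>i. x i j"]
        sum.subset_diff[OF A(1) fin(1), of "\<lambda>i. real (y i j)"] by simp
  qed
  then show ?thesis
    by (subst (1 2) sum.swap) (rule sum_mono)
qed

text \<open>An integral filling with least total violation of the row bounds has no violation at all.
  If row \<open>c\<close> were too large, no row reachable from \<open>c\<close> in the residual graph could be below its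
  upper bound, for otherwise moving a unit there would reduce the violation; then the
  reachable rows together exceed the sum of their upper bounds, which the cut estimate excludes
  because the real filling respects them. If \<open>c\<close> is too small, the same is done with the rows from
  which \<open>c\<close> is reachable.\<close>
theorem transport_rounding:
  fixes x :: "'a \<Rightarrow> 'b \<Rightarrow> real" and L U :: "'a \<Rightarrow> nat"
  assumes fin: "finite I" "finite J"
    and x: "\<And>i j. i \<in> I \<Longrightarrow> j \<in> J \<Longrightarrow> 0 \<le> x i j \<and> x i j \<le> real (m i j)"
    and colx: "\<And>j. j \<in> J \<Longrightarrow> (\<Sum>i\<in>I. x i j) = real (T j)"
    and rowx: "\<And>i. i \<in> I \<Longrightarrow> real (L i) \<le> (\<Sum>j\<in>J. x i j) \<and> (\<Sum>j\<in>J. x i j) \<le> real (U i)"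
  shows "\<exists>y\<in>fillings I J m T. \<forall>i\<in>I. L i \<le> (\<Sum>j\<in>J. y i j) \<and> (\<Sum>j\<in>J. y i j) \<le> U i"
proof -
  define row where "row y i = (\<Sum>j\<in>J. y i j)" for y :: "'a \<Rightarrow> 'b \<Rightarrow> nat" and i
  define err where "err y = (\<Sum>i\<in>I. (row y i - U i) + (L i - row y i))" for y
  have LU: "L i \<le> U i" if "i \<in> I" for i using rowx[OF that] by linarith
  have "T j \<le> (\<Sum>i\<in>I. m i j)" if "j \<in> J" for j
  proof -
    have "real (T j) \<le> real (\<Sum>i\<in>I. m i j)"
      using sum_mono[of I "\<lambda>i. x i j" "\<lambda>i. real (m i j)"] x colx[OF that] that by simp
    then show ?thesis by (simp only: of_nat_le_iff)
  qed
  then have "\<exists>y. y \<in> fillings I J m T" using fillings_nonempty[OF fin(1)] by blast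
  then obtain y where y: "y \<in> fillings I J m T"
    and least: "\<And>y'. y' \<in> fillings I J m T \<Longrightarrow> err y \<le> err y'"
    using ex_has_least_nat[of "\<lambda>y. y \<in> fillings I J m T" _ err] by metis
  let ?R = "movable I J m y"
  \<comment> \<open>No residual path leads from a row that can spare a unit to a row that can take one, if
    one of the two violates its bounds.\<close>
  have tight: "\<not> (L a < row y a \<and> row y b < U b \<and> (U a < row y a \<or> row y b < L b))"
    if reach: "(a, b) \<in> ?R\<^sup>*" and ab: "a \<in> I" "b \<in> I" for a b
  proof
    assume h: "L a < row y a \<and> row y b < U b \<and> (U a < row y a \<or> row y b < L b)"
    obtain p where p: "p \<noteq> []" "distinct p" "successively (\<lambda>u v. (u, v) \<in> ?R) p" "hd p = a" "last p = b"
      using rtrancl_distinct_path[OF reach] by blast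
    obtain y' where y': "y' \<in> fillings I J m T"
      "\<forall>i\<in>I. row y' i + of_bool (i = a) = row y i + of_bool (i = b)"
      using move_unit_along_path[OF fin y p(1-3)] p(4,5) unfolding row_def by blast
    have ne: "a \<noteq> b" using h LU[OF ab(1)] by auto
    have le: "(row y' i - U i) + (L i - row y' i) \<le> (row y i - U i) + (L i - row y i)" if "i \<in> I" for i
      using y'(2)[rule_format, OF that] h LU[OF that] ne
      by (cases "i = a"; cases "i = b") auto
    have "\<exists>i\<in>I. (row y' i - U i) + (L i - row y' i) < (row y i - U i) + (L i - row y i)"
    proof (cases "U a < row y a")
      case True
      then show ?thesis using y'(2)[rule_format, OF ab(1)] ne ab LU[OF ab(1)] h
        by (intro bexI[of _ a]) auto
    next
      case False
      then show ?thesis using y'(2)[rule_format, OF ab(2)] ne ab LU[OF ab(2)] h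
        by (intro bexI[of _ b]) auto
    qed
    then have "err y' < err y"
      unfolding err_def using fin le by (intro sum_strict_mono_ex1) auto
    then show False using least[OF y'(1)] by simp
  qed
  have "row y c \<le> U c" if c: "c \<in> I" for c
  proof (rule ccontr)
    assume over: "\<not> row y c \<le> U c"
    define A where "A = {b \<in> I. (c, b) \<in> ?R\<^sup>*}"
    have ge: "U b \<le> row y b" if "b \<in> A" for b
      using tight[of c b] that c over LU[OF c] by (auto simp: A_def)
    have "(\<Sum>i\<in>A. \<Sum>j\<in>J. real (y i j)) \<le> (\<Sum>i\<in>A. \<Sum>j\<in>J. x i j)"
    proof (rule closed_rows_sum_le[OF fin y x colx])
      show "b \<in> A" if "a \<in> A" "(a, b) \<in> ?R" for a b
        using that by (auto simp: A_def movable_def intro: rtrancl_into_rtrancl)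
    qed (auto simp: A_def)
    also have "\<dots> \<le> (\<Sum>i\<in>A. real (U i))" by (rule sum_mono) (use rowx in \<open>auto simp: A_def\<close>)
    finally have "real (\<Sum>i\<in>A. row y i) \<le> real (\<Sum>i\<in>A. U i)" by (simp add: row_def)
    moreover have "(\<Sum>i\<in>A. U i) < (\<Sum>i\<in>A. row y i)"
    proof (rule sum_strict_mono_ex1)
      show "\<exists>i\<in>A. U i < row y i" using c over by (intro bexI[of _ c]) (auto simp: A_def)
    qed (use fin ge in \<open>auto simp: A_def\<close>)
    ultimately show False by linarith
  qed
  moreover have "L c \<le> row y c" if c: "c \<in> I" for c
  proof (rule ccontr)
    assume under: "\<not> L c \<le> row y c"
    define B where "B = {a \<in> I. (a, c) \<in> ?R\<^sup>*}"
    have le: "row y a \<le> L a" if "a \<in> B" for a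
      using tight[of a c] that c under LU[OF c] by (auto simp: B_def)
    \<comment> \<open>The cut estimate bounds the rows outside \<open>B\<close> from above; as the totals agree, it bounds
      those in \<open>B\<close> from below.\<close>
    have "(\<Sum>i\<in>I - B. \<Sum>j\<in>J. real (y i j)) \<le> (\<Sum>i\<in>I - B. \<Sum>j\<in>J. x i j)"
    proof (rule closed_rows_sum_le[OF fin y x colx])
      show "b \<in> I - B" if "a \<in> I - B" "(a, b) \<in> ?R" for a b
        using that by (auto simp: B_def movable_def intro: converse_rtrancl_into_rtrancl)
    qed auto
    moreover have "(\<Sum>i\<in>I. \<Sum>j\<in>J. real (y i j)) = (\<Sum>i\<in>I. \<Sum>j\<in>J. x i j)"
    proof -
      have "(\<Sum>i\<in>I. real (y i j)) = (\<Sum>i\<in>I. x i j)" if "j \<in> J" for j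
        using y colx[OF that] that unfolding fillings_def by (simp flip: of_nat_sum)
      then show ?thesis by (subst (1 2) sum.swap) simp
    qed
    moreover have "B \<subseteq> I" by (auto simp: B_def)
    ultimately have "(\<Sum>i\<in>B. \<Sum>j\<in>J. x i j) \<le> (\<Sum>i\<in>B. \<Sum>j\<in>J. real (y i j))"
      using sum.subset_diff[of B I "\<lambda>i. \<Sum>j\<in>J. x i j"] fin(1)
        sum.subset_diff[of B I "\<lambda>i. \<Sum>j\<in>J. real (y i j)"] by linarith
    moreover have "(\<Sum>i\<in>B. real (L i)) \<le> (\<Sum>i\<in>B. \<Sum>j\<in>J. x i j)"
      by (rule sum_mono) (use rowx in \<open>auto simp: B_def\<close>)
    ultimately have "real (\<Sum>i\<in>B. L i) \<le> real (\<Sum>i\<in>B. row y i)" by (simp add: row_def)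
    moreover have "(\<Sum>i\<in>B. row y i) < (\<Sum>i\<in>B. L i)"
    proof (rule sum_strict_mono_ex1)
      show "\<exists>i\<in>B. row y i < L i" using c under by (intro bexI[of _ c]) (auto simp: B_def)
    qed (use fin le in \<open>auto simp: B_def\<close>)
    ultimately show False by linarith
  qed
  ultimately show ?thesis using y unfolding row_def by blast
qed

section \<open>Baranyai's theorem\<close>

definition small_subsets :: "nat \<Rightarrow> 'a set \<Rightarrow> 'a set set" where
  "small_subsets r W = {S. S \<subseteq> W \<and> card S \<le> r}"

lemma finite_small_subsets: "finite W \<Longrightarrow> finite (small_subsets r W)"
  by (rule finite_subset[of _ "Pow W"]) (auto simp: small_subsets_def)

lemma sum_small_subsets_insert:
  fixes g :: "'a set \<Rightarrow> nat"
  assumes "finite W" "v \<notin> W"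
  shows "sum g (small_subsets r (insert v W)) =
    sum g (small_subsets r W) + (\<Sum>S | S \<in> small_subsets r W \<and> card S < r. g (insert v S))"
proof -
  let ?D = "{S \<in> small_subsets r W. card S < r}"
  have fin: "finite S" if "S \<subseteq> W" for S using that assms finite_subset by blast
  have "small_subsets r (insert v W) = small_subsets r W \<union> insert v ` ?D" (is "?L = ?R")
  proof
    show "?L \<subseteq> ?R"
    proof
      fix S assume S: "S \<in> ?L"
      show "S \<in> ?R"
      proof (cases "v \<in> S")
        case True
        then have "S = insert v (S - {v})" "finite S" using S assms by (auto simp: small_subsets_def intro: finite_subset)
        moreover from this have "card S = Suc (card (S - {v}))" using True by (intro card.remove)
        then have "S - {v} \<in> ?D" using S by (auto simp: small_subsets_def simp del: card_Diff_insert)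
        ultimately show ?thesis by blast
      qed (use S in \<open>auto simp: small_subsets_def\<close>)
    qed
    show "?R \<subseteq> ?L" using assms fin by (auto simp: small_subsets_def card_insert_if)
  qed
  moreover have "small_subsets r W \<inter> insert v ` ?D = {}" using assms by (auto simp: small_subsets_def)
  moreover have "inj_on (insert v) ?D" using assms
    by (intro inj_onI) (auto simp: small_subsets_def insert_eq_iff)
  moreover have "finite (small_subsets r W)" using assms by (simp add: finite_small_subsets)
  ultimately show ?thesis
    by (simp add: sum.union_disjoint sum.reindex)
qed

text \<open>A coloring of the edges on \<open>n\<close> vertices after the \<open>n - card W\<close> vertices outside \<open>W\<close> have been
  identified: \<open>M i S\<close> counts the edges of color \<open>i\<close> whose trace on \<open>W\<close> is \<open>S\<close>. The first two conditions
  count the edges with a given trace and those with a given color. The third bounds the degrees at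
  the vertices of \<open>W\<close>. The fourth bounds the number of incidences of color \<open>i\<close> with the vertices still
  identified, so that the average degree there lies between the same bounds.\<close>
definition amalgamated_coloring ::
    "nat \<Rightarrow> nat \<Rightarrow> 'c set \<Rightarrow> ('c \<Rightarrow> nat) \<Rightarrow> ('c \<Rightarrow> nat) \<Rightarrow> ('c \<Rightarrow> nat) \<Rightarrow> 'a set \<Rightarrow> ('c \<Rightarrow> 'a set \<Rightarrow> nat) \<Rightarrow> bool"
  where "amalgamated_coloring n r I a L U W M \<longleftrightarrow>
    (\<forall>S\<in>small_subsets r W. (\<Sum>i\<in>I. M i S) = (n - card W) choose (r - card S)) \<and>
    (\<forall>i\<in>I. (\<Sum>S\<in>small_subsets r W. M i S) = a i) \<and>
    (\<forall>i\<in>I. \<forall>w\<in>W. (\<Sum>S\<in>small_subsets r W. of_bool (w \<in> S) * M i S) \<in> {L i..U i}) \<and>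
    (\<forall>i\<in>I. (\<Sum>S\<in>small_subsets r W. (r - card S) * M i S) \<in> {L i * (n - card W)..U i * (n - card W)})"

lemma pascal_minus:
  assumes "d \<ge> 1"
  shows "(d choose k) - (if k = 0 then 0 else (d - 1) choose (k - 1)) = (d - 1) choose k"
  using assms by (cases d; cases k) auto

lemma remainder_bounds:
  fixes A s R l u :: nat
  shows "A + s = R \<Longrightarrow> l \<le> R \<Longrightarrow> R - u \<le> s \<Longrightarrow> s \<le> R - l \<Longrightarrow> l \<le> A \<and> A \<le> u"
  by linarith

text \<open>If \<open>R\<close> incidences remain for \<open>d\<close> vertices, the degree given to the next vertex should lie in
  \<open>{l..u}\<close> and leave between \<open>l * (d - 1)\<close> and \<open>u * (d - 1)\<close> incidences for the others. The
  average \<open>R / d\<close> lies in the window so described, whose ends are integers.\<close>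
lemma window_contains_average:
  fixes d l u R :: nat
  assumes "d \<ge> 1" "l * d \<le> R" "R \<le> u * d"
  shows "max l (R - u * (d - 1)) * d \<le> R" "R \<le> min u (R - l * (d - 1)) * d"
proof -
  obtain e where e: "d = Suc e" using assms(1) by (cases d) auto
  have le: "l * e + l \<le> R" "R \<le> u * e + u" using assms(2,3) by (simp_all add: e)
  have "(R - u * e) * d \<le> R"
  proof (cases "R \<le> u * e")
    case False
    then obtain z where z: "R = u * e + z" by (metis nat_le_linear le_Suc_ex)
    then have "z * e \<le> u * e" using le(2) by (intro mult_le_mono1) simp
    then show ?thesis by (simp add: z e)
  qed simp
  moreover have "R \<le> (R - l * e) * d"
  proof -
    obtain z where z: "R = l * e + l + z" using le(1) le_Suc_ex by blast
    then have "R - l * e = l + z" by simp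
    then show ?thesis by (simp add: z e algebra_simps)
  qed
  moreover have "max l x * d \<le> R" if "x * d \<le> R" for x
    using that assms(2) by (simp add: max_def)
  moreover have "R \<le> min u x * d" if "R \<le> x * d" for x
    using that assms(3) by (simp add: min_def)
  moreover have "d - 1 = e" by (simp add: e)
  ultimately show "max l (R - u * (d - 1)) * d \<le> R" "R \<le> min u (R - l * (d - 1)) * d" by metis+
qed

text \<open>The vertex \<open>v\<close> is to be put into some of the edges counted by each \<open>M i S\<close>. By symmetry, the
  fraction \<open>(r - card S) / d\<close> of them is the fair share, where \<open>d\<close> vertices are still identified. The
  total of these shares over all colors is the integer required by Pascal's rule, and for
  each color the total over all traces is the average remaining degree. Rounding the matrix of fair
  shares therefore gives admissible numbers \<open>y i S\<close>.\<close>
lemma amalgamated_coloring_insert: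
  assumes fin: "finite I" "finite W" and v: "v \<notin> W" and n: "card W < n"
    and M: "amalgamated_coloring n r I a L U W M"
  shows "\<exists>M'. amalgamated_coloring n r I a L U (insert v W) M'"
proof -
  let ?J = "small_subsets r W"
  define d where "d = n - card W"
  have d: "d \<ge> 1" "n - card (insert v W) = d - 1" using n fin v by (auto simp: d_def)
  have colM: "(\<Sum>i\<in>I. M i S) = d choose (r - card S)" if "S \<in> ?J" for S
    using M that by (simp add: amalgamated_coloring_def d_def)
  define rest where "rest i = (\<Sum>S\<in>?J. (r - card S) * M i S)" for i
  have rest: "L i * d \<le> rest i" "rest i \<le> U i * d" if "i \<in> I" for i
    using M that by (auto simp: amalgamated_coloring_def d_def rest_def)
  have finJ: "finite ?J" using fin by (simp add: finite_small_subsets)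
  define T where "T S = (if r - card S = 0 then 0 else (d - 1) choose (r - card S - 1))" for S :: "'b set"
  define x where "x i S = real ((r - card S) * M i S) / real d" for i S
  define lo where "lo i = max (L i) (rest i - U i * (d - 1))" for i
  define hi where "hi i = min (U i) (rest i - L i * (d - 1))" for i
  have x_bounds: "0 \<le> x i S \<and> x i S \<le> real (M i S)" if "i \<in> I" "S \<in> ?J" for i S
  proof -
    have "(r - card S) * M i S \<le> d * M i S"
    proof (cases "M i S = 0")
      case False
      then have "0 < d choose (r - card S)"
        using colM[OF that(2)] that(1) fin(1) by (metis gr0I sum_eq_0_iff)
      then show ?thesis by simp
    qed simp
    then have "real ((r - card S) * M i S) \<le> real (M i S) * real d"
      by (metis mult.commute of_nat_le_iff of_nat_mult)
    then show ?thesis using d by (simp add: x_def divide_le_eq)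
  qed
  have x_col: "(\<Sum>i\<in>I. x i S) = real (T S)" if "S \<in> ?J" for S
  proof -
    have "(\<Sum>i\<in>I. x i S) = real ((r - card S) * (\<Sum>i\<in>I. M i S)) / real d"
      by (simp add: x_def sum_divide_distrib[symmetric] sum_distrib_left)
    also have "(r - card S) * (\<Sum>i\<in>I. M i S) = d * T S"
      unfolding colM[OF that] T_def using d times_binomial_minus1_eq[of "r - card S" d] by simp
    finally show ?thesis using d by simp
  qed
  have x_row: "real (lo i) \<le> (\<Sum>S\<in>?J. x i S) \<and> (\<Sum>S\<in>?J. x i S) \<le> real (hi i)" if "i \<in> I" for i
  proof -
    have eq: "(\<Sum>S\<in>?J. x i S) = real (rest i) / real d"
      by (simp add: x_def rest_def sum_divide_distrib[symmetric])
    have "lo i * d \<le> rest i" "rest i \<le> hi i * d"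
      unfolding lo_def hi_def using window_contains_average[OF d(1) rest[OF that]] .
    then have "real (lo i) * real d \<le> real (rest i)" "real (rest i) \<le> real (hi i) * real d"
      by (simp_all flip: of_nat_mult)
    then show ?thesis using d by (simp add: eq le_divide_eq divide_le_eq)
  qed
  obtain y where y: "y \<in> fillings I ?J M T" "\<forall>i\<in>I. lo i \<le> sum (y i) ?J \<and> sum (y i) ?J \<le> hi i"
    using transport_rounding[OF fin(1) finJ x_bounds x_col x_row] by blast
  have y_le: "y i S \<le> M i S" if "i \<in> I" "S \<in> ?J" for i S using y that by (auto simp: fillings_def)
  have y_col: "(\<Sum>i\<in>I. y i S) = T S" if "S \<in> ?J" for S using y that by (auto simp: fillings_def)
  have y_full: "y i S = 0" if "i \<in> I" "S \<in> ?J" "\<not> card S < r" for i S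
    using y_col[OF that(2)] that fin(1) by (simp add: T_def)
  define M' where "M' i S = (if v \<in> S then y i (S - {v}) else M i S - y i S)" for i S
  have M'_old: "M' i S = M i S - y i S" if "S \<in> ?J" for i S
    using that v by (auto simp: M'_def small_subsets_def)
  have M'_new: "M' i (insert v S) = y i S" if "S \<in> ?J" for i S
  proof -
    have "v \<notin> S" using that v by (auto simp: small_subsets_def)
    then show ?thesis by (simp add: M'_def)
  qed
  have split: "(\<Sum>S\<in>small_subsets r (insert v W). g S * M' i S) =
      (\<Sum>S\<in>?J. g S * (M i S - y i S) + g (insert v S) * y i S)" if i: "i \<in> I" for g i
  proof -
    have "(\<Sum>S | S \<in> ?J \<and> card S < r. g (insert v S) * M' i (insert v S)) =
        (\<Sum>S\<in>?J. g (insert v S) * y i S)"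
      using finJ y_full[OF i] by (intro sum.mono_neutral_cong_left) (auto simp: M'_new)
    then show ?thesis
      by (simp add: sum_small_subsets_insert[OF fin(2) v] sum.distrib M'_old)
  qed
  have card_ins: "card (insert v S) = Suc (card S)" if "S \<in> ?J" for S
    using that v fin(2) finite_subset[of S W] by (auto simp: small_subsets_def card_insert_if)
  show ?thesis
    unfolding amalgamated_coloring_def d(2)
  proof (intro exI[of _ M'] conjI ballI)
    fix S assume S: "S \<in> small_subsets r (insert v W)"
    show "(\<Sum>i\<in>I. M' i S) = (d - 1) choose (r - card S)"
    proof (cases "v \<in> S")
      case True
      have "finite S" using S fin(2) finite_subset[of S "insert v W"] by (auto simp: small_subsets_def)
      then have c: "card S = Suc (card (S - {v}))" using True by (rule card.remove)
      then have "S - {v} \<in> ?J" "card S \<le> r" using S by (auto simp: small_subsets_def)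
      then have "r - card (S - {v}) = Suc (r - card S)" unfolding c by linarith
      then have "T (S - {v}) = (d - 1) choose (r - card S)" unfolding T_def by simp
      then show ?thesis using True y_col[OF \<open>S - {v} \<in> ?J\<close>] by (simp add: M'_def)
    next
      case False
      then have SJ: "S \<in> ?J" using S by (auto simp: small_subsets_def)
      have "(\<Sum>i\<in>I. M' i S) = (\<Sum>i\<in>I. M i S) - (\<Sum>i\<in>I. y i S)"
        using y_le[OF _ SJ] by (simp add: M'_old[OF SJ] sum_subtractf_nat)
      then show ?thesis using pascal_minus[OF d(1), of "r - card S"]
        by (simp add: colM[OF SJ] y_col[OF SJ] T_def split: if_splits)
    qed
  next
    fix i assume i: "i \<in> I"
    have "(\<Sum>S\<in>small_subsets r (insert v W). M' i S) = (\<Sum>S\<in>?J. M i S)"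
      using split[OF i, of "\<lambda>_. 1"] y_le[OF i] by simp
    then show "(\<Sum>S\<in>small_subsets r (insert v W). M' i S) = a i"
      using M i by (simp add: amalgamated_coloring_def)
  next
    fix i w assume i: "i \<in> I" and w: "w \<in> insert v W"
    have eq: "(\<Sum>S\<in>small_subsets r (insert v W). of_bool (w \<in> S) * M' i S) =
        (if w = v then sum (y i) ?J else \<Sum>S\<in>?J. of_bool (w \<in> S) * M i S)"
    proof (cases "w = v")
      case True
      then show ?thesis unfolding split[OF i]
        using v by (auto intro!: sum.cong simp: small_subsets_def)
    next
      case False
      then show ?thesis unfolding split[OF i]
        using y_le[OF i] by (auto intro!: sum.cong)
    qed
    show "(\<Sum>S\<in>small_subsets r (insert v W). of_bool (w \<in> S) * M' i S) \<in> {L i..U i}"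
    proof (cases "w = v")
      case True
      then show ?thesis unfolding eq using y(2) i by (auto simp: lo_def hi_def)
    next
      case False
      then show ?thesis unfolding eq using M i w by (auto simp: amalgamated_coloring_def)
    qed
  next
    fix i assume i: "i \<in> I"
    have "(\<Sum>S\<in>small_subsets r (insert v W). (r - card S) * M' i S) + sum (y i) ?J =
        (\<Sum>S\<in>?J. (r - card S) * (M i S - y i S) + (r - card (insert v S)) * y i S + y i S)"
      unfolding split[OF i] by (simp add: sum.distrib)
    also have "\<dots> = rest i"
      unfolding rest_def
    proof (rule sum.cong)
      fix S assume S: "S \<in> ?J"
      show "(r - card S) * (M i S - y i S) + (r - card (insert v S)) * y i S + y i S = (r - card S) * M i S"
      proof (cases "card S < r")
        case True
        then obtain k where k: "r - card S = Suc k" "r - card (insert v S) = k"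
          using card_ins[OF S] by (metis Suc_diff_Suc)
        obtain z where "M i S = y i S + z" using y_le[OF i S] le_Suc_ex by blast
        then show ?thesis using k by (simp add: algebra_simps)
      next
        case False
        then show ?thesis using y_full[OF i S] by simp
      qed
    qed simp
    finally have "(\<Sum>S\<in>small_subsets r (insert v W). (r - card S) * M' i S) + sum (y i) ?J = rest i" .
    moreover have "L i * (d - 1) \<le> rest i"
      using rest(1)[OF i] by (meson diff_le_self le_trans mult_le_mono2)
    moreover have "rest i - U i * (d - 1) \<le> sum (y i) ?J" "sum (y i) ?J \<le> rest i - L i * (d - 1)"
      using y(2)[rule_format, OF i] max.cobounded2[of "rest i - U i * (d - 1)" "L i"]
        min.cobounded2[of "U i" "rest i - L i * (d - 1)"]
      unfolding lo_def hi_def by (meson order.trans)+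
    ultimately show "(\<Sum>S\<in>small_subsets r (insert v W). (r - card S) * M' i S) \<in> {L i * (d - 1)..U i * (d - 1)}"
      unfolding atLeastAtMost_iff by (rule remainder_bounds)
  qed
qed

text \<open>Baranyai's theorem with prescribed class sizes \<open>a i\<close>. The average degree of class \<open>i\<close> is
  \<open>r * a i / card V\<close>, and any integral bounds enclosing it can be imposed on all degrees. Once all
  vertices are distinguished, each \<open>r\<close>-set has total multiplicity one, hence exactly one color.\<close>
theorem baranyai:
  fixes V :: "'a set" and a L U :: "'c \<Rightarrow> nat"
  assumes fin: "finite V" "finite I"
    and total: "(\<Sum>i\<in>I. a i) = card V choose r"
    and L: "\<And>i. i \<in> I \<Longrightarrow> L i * card V \<le> r * a i"
    and U: "\<And>i. i \<in> I \<Longrightarrow> r * a i \<le> U i * card V"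
  shows "\<exists>c. (\<forall>e. e \<subseteq> V \<and> card e = r \<longrightarrow> c e \<in> I) \<and>
    (\<forall>i\<in>I. card {e. e \<subseteq> V \<and> card e = r \<and> c e = i} = a i) \<and>
    (\<forall>i\<in>I. \<forall>v\<in>V. card {e. e \<subseteq> V \<and> card e = r \<and> c e = i \<and> v \<in> e} \<in> {L i..U i})"
proof -
  have "\<exists>M. amalgamated_coloring (card V) r I a L U W M" if "W \<subseteq> V" for W
  proof -
    have "finite W" using that fin(1) finite_subset by blast
    then show ?thesis using that
    proof (induction W rule: finite_induct)
      case empty
      have J: "small_subsets r {} = {{} :: 'a set}" by (auto simp: small_subsets_def)
      have "amalgamated_coloring (card V) r I a L U {} (\<lambda>i (_ :: 'a set). a i)"
        using total L U by (simp add: amalgamated_coloring_def J)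
      then show ?case by blast
    next
      case (insert v W)
      then obtain M where "amalgamated_coloring (card V) r I a L U W M" by blast
      moreover have "card W < card V" using insert.prems insert.hyps fin(1) by (intro psubset_card_mono) auto
      ultimately show ?case by (rule amalgamated_coloring_insert[OF fin(2) insert.hyps(1,2), rotated])
    qed
  qed
  then obtain M where M: "amalgamated_coloring (card V) r I a L U V M" by blast
  let ?J = "small_subsets r V"
  have finJ: "finite ?J" using fin(1) by (simp add: finite_small_subsets)
  have col: "(\<Sum>i\<in>I. M i S) = of_bool (card S = r)" if "S \<in> ?J" for S
    using M that by (auto simp: amalgamated_coloring_def small_subsets_def)
  have "\<exists>i\<in>I. \<forall>j\<in>I. M j e = of_bool (j = i)" if e: "e \<subseteq> V \<and> card e = r" for e
  proof -
    have "(\<Sum>i\<in>I. M i e) = 1" using col[of e] e by (auto simp: small_subsets_def)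
    then obtain i where "i \<in> I" "M i e = 1" "\<forall>j\<in>I. i \<noteq> j \<longrightarrow> M j e = 0"
      using sum_eq_1_iff[OF fin(2), of "\<lambda>i. M i e"] by blast
    then show ?thesis by (intro bexI[of _ i]) auto
  qed
  then have "\<forall>e. \<exists>i. e \<subseteq> V \<and> card e = r \<longrightarrow> i \<in> I \<and> (\<forall>j\<in>I. M j e = of_bool (j = i))" by blast
  then obtain c where c: "\<And>e. e \<subseteq> V \<and> card e = r \<Longrightarrow> c e \<in> I \<and> (\<forall>j\<in>I. M j e = of_bool (j = c e))"
    using choice[of "\<lambda>e i. e \<subseteq> V \<and> card e = r \<longrightarrow> i \<in> I \<and> (\<forall>j\<in>I. M j e = of_bool (j = i))"] by blast
  have M_eq: "M i S = of_bool (card S = r \<and> c S = i)" if "i \<in> I" "S \<in> ?J" for i S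
  proof (cases "card S = r")
    case True
    then show ?thesis using c[of S] that by (auto simp: small_subsets_def)
  next
    case False
    then show ?thesis using col[OF that(2)] that(1) fin(2) by simp
  qed
  have count: "(\<Sum>S\<in>?J. of_bool (P S) * M i S) = card {e. e \<subseteq> V \<and> card e = r \<and> c e = i \<and> P e}"
    if "i \<in> I" for i P
  proof -
    have "(\<Sum>S\<in>?J. of_bool (P S) * M i S) = (\<Sum>S\<in>?J. of_bool (card S = r \<and> c S = i \<and> P S))"
      using M_eq[OF that] by (intro sum.cong) auto
    also have "\<dots> = card (?J \<inter> {e. card e = r \<and> c e = i \<and> P e})" using finJ by simp
    also have "?J \<inter> {e. card e = r \<and> c e = i \<and> P e} = {e. e \<subseteq> V \<and> card e = r \<and> c e = i \<and> P e}"
      by (auto simp: small_subsets_def)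
    finally show ?thesis .
  qed
  show ?thesis
  proof (intro exI[of _ c] conjI ballI allI impI)
    show "c e \<in> I" if "e \<subseteq> V \<and> card e = r" for e using c[OF that] by blast
    show "card {e. e \<subseteq> V \<and> card e = r \<and> c e = i} = a i" if "i \<in> I" for i
      using count[OF that, of "\<lambda>_. True"] M that by (simp add: amalgamated_coloring_def)
    show "card {e. e \<subseteq> V \<and> card e = r \<and> c e = i \<and> v \<in> e} \<in> {L i..U i}" if "i \<in> I" "v \<in> V" for i v
    proof -
      have "(\<Sum>S\<in>?J. of_bool (v \<in> S) * M i S) \<in> {L i..U i}"
        using M that unfolding amalgamated_coloring_def by blast
      then show ?thesis unfolding count[OF that(1)] .
    qed
  qed
qed

section \<open>Counting components\<close>

lemma equiv_adjacency: "equiv UNIV ((adjacency E)\<^sup>*)"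
proof (rule equivI)
  show "sym ((adjacency E)\<^sup>*)" by (rule sym_rtrancl) (auto simp: adjacency_def sym_def)
qed (auto simp: refl_on_def trans_rtrancl)

lemma adjacency_class_eq_iff:
  "(adjacency E)\<^sup>* `` {x} = (adjacency E)\<^sup>* `` {y} \<longleftrightarrow> (x, y) \<in> (adjacency E)\<^sup>*"
  using eq_equiv_class_iff[OF equiv_adjacency[of E], of x y] by simp

lemma card_components_le:
  assumes "finite E"
  shows "card (components E) \<le> card E"
proof -
  have "components E \<subseteq> (\<lambda>e. (adjacency E)\<^sup>* `` {SOME u. u \<in> e}) ` E"
  proof
    fix X assume "X \<in> components E"
    then obtain v e where v: "e \<in> E" "v \<in> e" "X = (adjacency E)\<^sup>* `` {v}"
      by (auto simp: components_def quotient_def)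
    have "(SOME u. u \<in> e) \<in> e" using v(2) by (rule someI)
    then have "(v, SOME u. u \<in> e) \<in> (adjacency E)\<^sup>*" using v by (auto simp: adjacency_def)
    then have "X = (adjacency E)\<^sup>* `` {SOME u. u \<in> e}" using v(3) by (simp add: adjacency_class_eq_iff)
    then show "X \<in> (\<lambda>e. (adjacency E)\<^sup>* `` {SOME u. u \<in> e}) ` E" using v(1) by blast
  qed
  then show ?thesis using assms by (meson surj_card_le)
qed

lemma rtrancl_adjacency_insert:
  assumes "(x, y) \<in> (adjacency (insert e E))\<^sup>*"
  shows "(x, y) \<in> (adjacency E)\<^sup>* \<or> (\<exists>u\<in>e. \<exists>v\<in>e. (x, u) \<in> (adjacency E)\<^sup>* \<and> (v, y) \<in> (adjacency E)\<^sup>*)"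
  using assms
proof (induction rule: rtrancl_induct)
  case (step y z)
  show ?case
  proof (cases "(y, z) \<in> adjacency E")
    case True
    then show ?thesis using step.IH by (meson rtrancl.rtrancl_into_rtrancl)
  next
    case False
    then have "y \<in> e" "z \<in> e" using step.hyps by (auto simp: adjacency_def)
    then show ?thesis using step.IH by blast
  qed
qed simp

text \<open>The new edge \<open>e\<close> merges only the classes that it meets. After discarding the classes of all its
  vertices but one vertex \<open>u0\<close>, at most \<open>card e - 1\<close> of them, distinct classes stay distinct.\<close>
lemma card_quotient_adjacency_insert:
  assumes fin: "finite V" "finite e"
  shows "card (V // (adjacency E)\<^sup>*) \<le> card (V // (adjacency (insert e E))\<^sup>*) + (card e - 1)"
proof (cases "e = {}")
  case True
  then have "adjacency (insert e E) = adjacency E" by (auto simp: adjacency_def)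
  then show ?thesis by simp
next
  case False
  then obtain u0 where u0: "u0 \<in> e" by blast
  let ?R = "(adjacency E)\<^sup>*" and ?R' = "(adjacency (insert e E))\<^sup>*"
  define W where "W = (\<lambda>u. ?R `` {u}) ` (e - {u0})"
  define Z where "Z = V // ?R - W"
  have sub: "?R \<subseteq> ?R'" by (rule rtrancl_mono) (auto simp: adjacency_def)
  have fq: "finite (V // S)" for S :: "('a \<times> 'a) set" using fin by (simp add: quotient_def)
  have sat: "?R' `` (?R `` {x}) = ?R' `` {x}" for x
    using sub by (auto intro: rtrancl_trans)
  have "inj_on (\<lambda>X. ?R' `` X) Z"
  proof (rule inj_onI)
    fix X Y assume X: "X \<in> Z" and Y: "Y \<in> Z" and eq: "?R' `` X = ?R' `` Y"
    obtain x y where xy: "X = ?R `` {x}" "Y = ?R `` {y}"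
      using X Y by (auto simp: Z_def quotient_def)
    have "(x, y) \<in> ?R'" using eq by (simp only: xy sat adjacency_class_eq_iff)
    then consider "(x, y) \<in> ?R" | u v where "u \<in> e" "v \<in> e" "(x, u) \<in> ?R" "(v, y) \<in> ?R"
      using rtrancl_adjacency_insert by metis
    then show "X = Y"
    proof cases
      case 1
      then show ?thesis by (simp add: xy adjacency_class_eq_iff)
    next
      case 2
      then have "X = ?R `` {u}" "Y = ?R `` {v}"
        by (simp_all add: xy flip: adjacency_class_eq_iff)
      moreover from this have "u = u0" "v = u0" using X Y 2 by (auto simp: Z_def W_def)
      ultimately show ?thesis by simp
    qed
  qed
  moreover have "(\<lambda>X. ?R' `` X) ` Z \<subseteq> V // ?R'"
    by (auto simp: Z_def quotient_def sat)
  ultimately have Z: "card Z \<le> card (V // ?R')" using fq by (metis card_inj_on_le)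
  have "card W \<le> card (e - {u0})" unfolding W_def using fin by (intro card_image_le) auto
  then have W: "card W \<le> card e - 1" using u0 fin by simp
  have "V // ?R \<subseteq> Z \<union> W" by (auto simp: Z_def)
  then have "card (V // ?R) \<le> card (Z \<union> W)" using fq fin by (intro card_mono) (auto simp: Z_def W_def)
  also have "\<dots> \<le> card Z + card W" by (rule card_Un_le)
  finally show ?thesis using Z W by simp
qed

text \<open>Starting from the isolated vertices of \<open>\<Union>E\<close>, insert the edges one by one.\<close>
lemma card_vertices_le_components:
  assumes "finite E" "\<And>e. e \<in> E \<Longrightarrow> finite e"
  shows "card (\<Union>E) \<le> card (components E) + (\<Sum>e\<in>E. card e - 1)"
proof -
  have fV: "finite (\<Union>E)" using assms by blast
  have "card (\<Union>E) \<le> card (\<Union>E // (adjacency F)\<^sup>*) + (\<Sum>e\<in>F. card e - 1)" if "finite F" "F \<subseteq> E" for F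
    using that
  proof (induction F rule: finite_induct)
    case empty
    have "adjacency {} = ({} :: ('a \<times> 'a) set)" by (auto simp: adjacency_def)
    moreover have "\<Union>E // (Id :: ('a \<times> 'a) set) = (\<lambda>x. {x}) ` \<Union>E" by (auto simp: quotient_def)
    ultimately show ?case by (simp add: card_image)
  next
    case (insert e F)
    then show ?case using card_quotient_adjacency_insert[OF fV, of e F] assms by auto
  qed
  then show ?thesis using assms(1) by (auto simp: components_def)
qed

text \<open>The two alternatives on the degrees give the number of covered vertices: it is
  \<open>r * card E\<close> if the edges are disjoint, and at least \<open>card V\<close> if no vertex is missed.\<close>
lemma card_components_near_matching:
  assumes "finite V" and E: "\<And>e. e \<in> E \<Longrightarrow> e \<subseteq> V \<and> card e = r"
    and "(\<forall>v\<in>V. card {e \<in> E. v \<in> e} \<le> 1) \<or> (\<forall>v\<in>V. card {e \<in> E. v \<in> e} \<ge> 1)"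
  shows "min (card V) (r * card E) \<le> card (components E) + (r - 1) * card E"
proof -
  have fE: "finite E" using assms(1) E by (intro finite_subset[of E "Pow V"]) auto
  have fe: "finite e" if "e \<in> E" for e using E[OF that] assms(1) finite_subset by blast
  have "min (card V) (r * card E) \<le> card (\<Union>E)"
    using assms(3)
  proof
    assume *: "\<forall>v\<in>V. card {e \<in> E. v \<in> e} \<le> 1"
    have "disjnt e e'" if "e \<in> E" "e' \<in> E" "e \<noteq> e'" for e e'
    proof (rule ccontr)
      assume "\<not> disjnt e e'"
      then obtain v where v: "v \<in> e" "v \<in> e'" by (auto simp: disjnt_def)
      then have "card {e, e'} \<le> card {e \<in> E. v \<in> e}" using that fE by (intro card_mono) auto
      moreover have "v \<in> V" using v E that by blast
      moreover have "card {e, e'} = 2" using that by simp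
      ultimately show False using * by force
    qed
    then have "card (\<Union>E) = (\<Sum>e\<in>E. card e)" using fe by (intro card_Union_disjoint) (auto simp: pairwise_def)
    also have "\<dots> = r * card E" using E by simp
    finally show ?thesis by simp
  next
    assume *: "\<forall>v\<in>V. card {e \<in> E. v \<in> e} \<ge> 1"
    have "V \<subseteq> \<Union>E"
    proof
      fix v assume "v \<in> V"
      then have "{e \<in> E. v \<in> e} \<noteq> {}" using * by (metis card.empty not_one_le_zero)
      then show "v \<in> \<Union>E" by blast
    qed
    then have "card V \<le> card (\<Union>E)" using fE fe by (intro card_mono) auto
    then show ?thesis by simp
  qed
  also have "\<dots> \<le> card (components E) + (\<Sum>e\<in>E. card e - 1)"
    by (rule card_vertices_le_components[OF fE fe])
  also have "(\<Sum>e\<in>E. card e - 1) = (r - 1) * card E" using E by simp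
  finally show ?thesis .
qed

section \<open>Colorings attaining the average class size\<close>

lemma card_complete_hypergraph: "card (complete_hypergraph n r) = n choose r"
  unfolding complete_hypergraph_def by (simp add: n_subsets)

lemma finite_complete_hypergraph: "finite (complete_hypergraph n r)"
  by (rule finite_subset[of _ "Pow {1..n}"]) (auto simp: complete_hypergraph_def)

lemma sum_card_color_class:
  assumes "c \<in> complete_hypergraph n r \<rightarrow> {1..k}"
  shows "(\<Sum>i\<in>{1..k}. card (color_class n r c i)) = n choose r"
proof -
  have "(\<Sum>i\<in>{1..k}. card (color_class n r c i)) = card (\<Union>i\<in>{1..k}. color_class n r c i)"
    by (subst card_UN_disjoint) (auto simp: color_class_def finite_complete_hypergraph)
  also have "(\<Union>i\<in>{1..k}. color_class n r c i) = complete_hypergraph n r"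
    using assms by (auto simp: color_class_def)
  finally show ?thesis by (simp add: card_complete_hypergraph)
qed

lemma min_components_le:
  assumes "k \<ge> 1" "c \<in> complete_hypergraph n r \<rightarrow> {1..k}"
  shows "min_components n k r c \<le> (n choose r) div k"
proof -
  have "min_components n k r c \<le> card (color_class n r c i)" if "i \<in> {1..k}" for i
  proof -
    have "min_components n k r c \<le> card (components (color_class n r c i))"
      using that unfolding min_components_def by (intro Min_le) auto
    also have "\<dots> \<le> card (color_class n r c i)"
      by (rule card_components_le) (simp add: color_class_def finite_complete_hypergraph)
    finally show ?thesis .
  qed
  then have "(\<Sum>i\<in>{1..k}. min_components n k r c) \<le> (\<Sum>i\<in>{1..k}. card (color_class n r c i))"
    by (rule sum_mono)
  then have "k * min_components n k r c \<le> n choose r"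
    unfolding sum_card_color_class[OF assms(2)] by simp
  then show ?thesis using assms(1) by (simp add: less_eq_div_iff_mult_less_eq mult.commute)
qed

text \<open>The maximum is over extensional colorings, so an arbitrary coloring is first restricted to the
  edges, which leaves its classes unchanged.\<close>
lemma f_hyp_eqI:
  assumes k: "k \<ge> 1" and c: "c \<in> complete_hypergraph n r \<rightarrow> {1..k}"
    and many: "\<And>i. i \<in> {1..k} \<Longrightarrow> (n choose r) div k \<le> card (components (color_class n r c i))"
  shows "f_hyp n k r = (n choose r) div k"
proof -
  let ?c = "restrict c (complete_hypergraph n r)"
  have cc: "?c \<in> complete_hypergraph n r \<rightarrow>\<^sub>E {1..k}" using c by auto
  have "color_class n r ?c i = color_class n r c i" for i by (auto simp: color_class_def)
  then have "(n choose r) div k \<le> min_components n k r ?c"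
    using k many unfolding min_components_def by (subst Min_ge_iff) auto
  moreover have "min_components n k r ?c \<le> (n choose r) div k"
    using min_components_le[OF k] cc by (simp add: PiE_def)
  ultimately have "(n choose r) div k \<in> min_components n k r ` (complete_hypergraph n r \<rightarrow>\<^sub>E {1..k})"
    using cc by (metis dual_order.antisym image_eqI)
  then show ?thesis
    unfolding f_hyp_def using min_components_le[OF k]
    by (intro Max_eqI) (auto simp: PiE_def intro!: finite_PiE[unfolded PiE_def] finite_complete_hypergraph)
qed

lemma sum_balanced:
  fixes N k :: nat
  assumes "k \<ge> 1"
  shows "(\<Sum>i\<in>{1..k}. N div k + of_bool (i \<le> N mod k)) = N"
proof -
  have "N mod k \<le> k" using assms by (simp add: less_imp_le)
  then have "{1..k} \<inter> {i. i \<le> N mod k} = {1..N mod k}" by auto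
  then show ?thesis by (simp add: sum.distrib)
qed

text \<open>A coloring with evenly spread classes of sizes \<open>q\<close> and \<open>q + 1\<close> attains the upper bound. The
  classes of size \<open>q\<close> are matchings. Those of size \<open>q + 1\<close>, which exist only if \<open>k\<close> does not divide
  \<open>n choose r\<close>, are matchings or, if \<open>r * (q + 1) = n + 1\<close>, cover all \<open>n\<close> vertices and so have at
  least \<open>n - (r - 1) * (q + 1) = q\<close> components.\<close>
theorem f_hyp_eq_average:
  assumes k: "k \<ge> 1" and r: "r \<ge> 1" and n: "n \<ge> 1"
    and q: "q = (n choose r) div k" and small: "r * q \<le> n"
    and large: "\<not> k dvd (n choose r) \<Longrightarrow> r * (q + 1) \<le> n + 1"
  shows "f_hyp n k r = q"
proof -
  let ?N = "n choose r"
  define a where "a i = q + of_bool (i \<le> ?N mod k)" for i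
  \<comment> \<open>If \<open>r * a i \<le> n\<close>, the degrees are at most 1; otherwise \<open>r * a i = n + 1\<close> and they are at least 1
    and, since \<open>n + 1 \<le> 2 * n\<close>, can be kept at most 2.\<close>
  define L U where "L i = (r * a i) div n" and "U i = (if r * a i \<le> n then 1 else 2 :: nat)" for i
  have a_cases: "r * a i \<le> n \<or> (a i = q + 1 \<and> r * (q + 1) = n + 1)" if "i \<in> {1..k}" for i
  proof (cases "i \<le> ?N mod k")
    case True
    then have "\<not> k dvd ?N" using that by (auto simp: dvd_eq_mod_eq_0)
    then show ?thesis using large True by (auto simp: a_def)
  qed (use small in \<open>simp add: a_def\<close>)
  have "\<exists>c. (\<forall>e. e \<subseteq> {1..n} \<and> card e = r \<longrightarrow> c e \<in> {1..k}) \<and>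
    (\<forall>i\<in>{1..k}. card {e. e \<subseteq> {1..n} \<and> card e = r \<and> c e = i} = a i) \<and>
    (\<forall>i\<in>{1..k}. \<forall>v\<in>{1..n}. card {e. e \<subseteq> {1..n} \<and> card e = r \<and> c e = i \<and> v \<in> e} \<in> {L i..U i})"
  proof (rule baranyai)
    show "(\<Sum>i\<in>{1..k}. a i) = card {1..n} choose r" using sum_balanced[OF k, of ?N] by (simp add: a_def q)
    show "r * a i \<le> U i * card {1..n}" if "i \<in> {1..k}" for i
      using a_cases[OF that] n by (auto simp: U_def)
  qed (auto simp: L_def)
  then obtain c where c: "\<And>e. e \<subseteq> {1..n} \<and> card e = r \<Longrightarrow> c e \<in> {1..k}"
    and size: "\<And>i. i \<in> {1..k} \<Longrightarrow> card {e. e \<subseteq> {1..n} \<and> card e = r \<and> c e = i} = a i"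
    and deg: "\<And>i v. i \<in> {1..k} \<Longrightarrow> v \<in> {1..n} \<Longrightarrow>
      card {e. e \<subseteq> {1..n} \<and> card e = r \<and> c e = i \<and> v \<in> e} \<in> {L i..U i}"
    by blast
  have "q \<le> card (components (color_class n r c i))" if i: "i \<in> {1..k}" for i
  proof -
    let ?E = "color_class n r c i"
    have E: "?E = {e. e \<subseteq> {1..n} \<and> card e = r \<and> c e = i}"
      by (auto simp: color_class_def complete_hypergraph_def)
    have Ev: "{e \<in> ?E. v \<in> e} = {e. e \<subseteq> {1..n} \<and> card e = r \<and> c e = i \<and> v \<in> e}" for v
      by (auto simp: E)
    have "min (card {1..n}) (r * card ?E) \<le> card (components ?E) + (r - 1) * card ?E"
    proof (rule card_components_near_matching)
      show "(\<forall>v\<in>{1..n}. card {e \<in> ?E. v \<in> e} \<le> 1) \<or> (\<forall>v\<in>{1..n}. card {e \<in> ?E. v \<in> e} \<ge> 1)"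
      proof (cases "r * a i \<le> n")
        case True
        then show ?thesis using deg[OF i] unfolding Ev U_def by auto
      next
        case False
        then have "1 \<le> L i" using n by (simp add: L_def less_eq_div_iff_mult_less_eq)
        then show ?thesis using deg[OF i] unfolding Ev by fastforce
      qed
    qed (auto simp: E)
    then have "min n (r * a i) \<le> card (components ?E) + (r - 1) * a i" using size[OF i] by (simp add: E)
    moreover have "r * a i = (r - 1) * a i + a i" using r by (cases r) auto
    moreover have "q \<le> a i" by (simp add: a_def)
    ultimately show ?thesis using a_cases[OF i] by (auto simp: min_def split: if_splits)
  qed
  then show ?thesis
    using f_hyp_eqI[OF k, of c n r] c by (auto simp: q complete_hypergraph_def)
qed

section \<open>Binomial estimates and the five cases\<close>

lemma choose_two_double: "2 * (n choose 2) = n * (n - 1)"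
  by (cases n) (simp_all add: choose_two)

text \<open>By Pascal's rule, the step from \<open>n\<close> to \<open>n + 1\<close> adds \<open>n choose (r - 1)\<close> on the right and
  takes away only \<open>(n - r) choose (r - 1)\<close>.\<close>
lemma choose_diff_mono:
  assumes "m \<le> n" "r \<ge> 1" "r \<le> m"
  shows "(m choose r) - ((m - r) choose r) \<le> (n choose r) - ((n - r) choose r)"
  using assms(1)
proof (induction n rule: dec_induct)
  case (step n)
  obtain s where s: "r = Suc s" using assms(2) by (cases r) auto
  have "(n - r) choose s \<le> n choose s" by (rule binomial_right_mono) simp
  moreover have "Suc n - r = Suc (n - r)" using step assms by simp
  ultimately have "(n choose r) - ((n - r) choose r) \<le> (Suc n choose r) - ((Suc n - r) choose r)"
    by (simp add: s)
  then show ?case using step.IH by linarith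
qed simp

text \<open>For \<open>r \<le> n\<close> the difference is the number of \<open>r\<close>-subsets of an \<open>n\<close>-set that meet a fixed one.
  Among \<open>n div r\<close> disjoint \<open>r\<close>-subsets at least one meets any given \<open>r\<close>-subset, as fewer than \<open>r\<close>
  points lie outside all of them. The proof removes one such block at a time.\<close>
lemma choose_le_blocks:
  assumes "r \<ge> 1"
  shows "n choose r \<le> (n div r) * ((n choose r) - ((n - r) choose r))"
proof (induction n rule: less_induct)
  case (less n)
  let ?D = "\<lambda>n. (n choose r) - ((n - r) choose r)"
  have le: "(n - r) choose r \<le> n choose r" by (rule binomial_right_mono) simp
  consider "n < r" | "r \<le> n" "n - r < r" | "r \<le> n - r" "r \<le> n" by linarith
  then show ?case
  proof cases
    case 1
    then show ?thesis by simp
  next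
    case 2
    then have "n div r \<ge> 1" using assms by (simp add: less_eq_div_iff_mult_less_eq)
    then show ?thesis using 2 by (simp add: binomial_eq_0)
  next
    case 3
    have "(n - r) choose r \<le> ((n - r) div r) * ?D (n - r)" using less.IH[of "n - r"] 3 assms by simp
    also have "\<dots> \<le> ((n - r) div r) * ?D n" using choose_diff_mono[of "n - r" n r] 3 assms by simp
    finally have "n choose r \<le> ?D n + ((n - r) div r) * ?D n" using le by linarith
    moreover have "n div r = Suc ((n - r) div r)" using 3 assms by (simp add: div_if)
    ultimately show ?thesis by simp
  qed
qed

theorem theorem1p2:
  shows "(\<forall>n::nat. n \<ge> 2 \<and> n - 1 \<le> n choose 2 \<longrightarrow>
            int (f_graph n (n - 1)) = \<lfloor>real n / 2\<rfloor>) \<and>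
         (\<forall>n::nat. n \<ge> 2 \<and> n \<le> n choose 2 \<longrightarrow>
            int (f_graph n n) = \<lfloor>(real n - 1) / 2\<rfloor>) \<and>
         (\<forall>n k :: nat. n \<ge> 2 \<and> k \<ge> 1 \<and> k \<le> n choose 2 \<and> k \<ge> n - 1 \<and> k dvd (n choose 2) \<longrightarrow>
            real (f_graph n k) = real n * (real n - 1) / (2 * real k)) \<and>
         (\<forall>n k r t :: nat. n \<ge> r \<and> r \<ge> 2 \<and> k \<ge> 1 \<and> k \<le> n choose r \<and> t \<ge> 1 \<and> r * t dvd n \<and>
            real k = real t * fact (n - 1) / (fact (r - 1) * fact (n - r)) \<longrightarrow>
            real (f_hyp n k r) = real n / (real r * real t)) \<and>
         (\<forall>n k r :: nat. n \<ge> r \<and> r \<ge> 2 \<and> k \<ge> 1 \<and> k \<le> n choose r \<and>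
            int k \<ge> int (n choose r) - int ((n - r) choose r) \<longrightarrow>
            int (f_hyp n k r) = \<lfloor>real (n choose r) / real k\<rfloor>)"
proof (intro conjI allI impI; elim conjE)
  fix n :: nat assume n: "n \<ge> 2"
  have "(n choose 2) div (n - 1) = n div 2"
    unfolding choose_two div_mult2_eq[symmetric] using n by simp
  then have "f_graph n (n - 1) = n div 2"
  proof (intro f_hyp_eq_average)
    assume "\<not> n - 1 dvd (n choose 2)"
    then have "odd n" by (auto elim!: evenE simp: choose_two)
    then show "2 * (n div 2 + 1) \<le> n + 1" by (auto elim: oddE)
  qed (use n in auto)
  then show "int (f_graph n (n - 1)) = \<lfloor>real n / 2\<rfloor>"
    using floor_divide_of_nat_eq[of n 2, where ?'a = real] by (simp add: zdiv_int)
next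
  fix n :: nat assume n: "n \<ge> 2"
  have "(n choose 2) div n = (n - 1) div 2"
    unfolding choose_two div_mult2_eq[symmetric] using n by (simp add: mult.commute)
  then have "f_graph n n = (n - 1) div 2"
    using n by (intro f_hyp_eq_average) auto
  moreover have "(real n - 1) / 2 = real (n - 1) / real 2" using n by simp
  ultimately show "int (f_graph n n) = \<lfloor>(real n - 1) / 2\<rfloor>"
    using floor_divide_of_nat_eq[of "n - 1" 2, where ?'a = real] by (simp add: zdiv_int)
next
  fix n k :: nat assume n: "n \<ge> 2" and k: "k \<ge> 1" "k \<ge> n - 1" and dvd: "k dvd (n choose 2)"
  obtain q where q: "n choose 2 = k * q" using dvd by blast
  have double: "2 * (k * q) = n * (n - 1)" using choose_two_double[of n] q by simp
  also have "\<dots> \<le> n * k" using k by simp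
  finally have "2 * q \<le> n" using k by simp
  then have "f_graph n k = q" using n k q by (intro f_hyp_eq_average) auto
  moreover have "2 * (real k * real q) = real n * (real n - 1)"
    using arg_cong[OF double, of real] n by simp
  ultimately show "real (f_graph n k) = real n * (real n - 1) / (2 * real k)"
    using k by (simp add: field_simps)
next
  fix n k r t :: nat
  assume r: "n \<ge> r" "r \<ge> 2" and k: "k \<ge> 1" and t: "t \<ge> 1" "r * t dvd n"
    and eq: "real k = real t * fact (n - 1) / (fact (r - 1) * fact (n - r))"
  obtain q where q: "n = r * t * q" using t(2) by blast
  have "real ((n - 1) choose (r - 1)) = fact (n - 1) / (fact (r - 1) * fact (n - r))"
    using r binomial_fact[of "r - 1" "n - 1", where ?'a = real] by simp
  then have "real k = real (t * ((n - 1) choose (r - 1)))" using eq by simp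
  then have k_eq: "k = t * ((n - 1) choose (r - 1))" by (simp only: of_nat_eq_iff)
  have "r * (n choose r) = n * ((n - 1) choose (r - 1))" using r by (intro times_binomial_minus1_eq) simp
  also have "\<dots> = r * (k * q)" by (simp add: q k_eq)
  finally have N: "n choose r = k * q" using r by simp
  have "r * q \<le> n" using t(1) by (simp add: q)
  then have "f_hyp n k r = q" using r k N by (intro f_hyp_eq_average) auto
  then show "real (f_hyp n k r) = real n / (real r * real t)" using r t by (simp add: q)
next
  fix n k r :: nat
  assume r: "n \<ge> r" "r \<ge> 2" and k: "k \<ge> 1" and D: "int k \<ge> int (n choose r) - int ((n - r) choose r)"
  define q where "q = (n choose r) div k"
  have "n choose r \<le> (n div r) * ((n choose r) - ((n - r) choose r))" using r by (intro choose_le_blocks) simp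
  also have "\<dots> \<le> (n div r) * k" using D by (intro mult_left_mono) auto
  finally have bound: "n choose r \<le> (n div r) * k" .
  have "q * k \<le> n choose r" by (simp add: q_def)
  then have "q * k \<le> (n div r) * k" using bound by linarith
  then have "q \<le> n div r" using k by simp
  then have small: "r * q \<le> n" by (metis dual_order.trans mult_le_mono2 times_div_less_eq_dividend)
  have "f_hyp n k r = q"
  proof (rule f_hyp_eq_average[OF k _ _ q_def small])
    assume "\<not> k dvd (n choose r)"
    then have "q * k < n choose r" using \<open>q * k \<le> n choose r\<close> by (metis dvd_triv_right le_neq_implies_less)
    then have "q * k < (n div r) * k" using bound by linarith
    then have "q + 1 \<le> n div r" by simp
    then have "r * (q + 1) \<le> n" by (metis dual_order.trans mult_le_mono2 times_div_less_eq_dividend)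
    then show "r * (q + 1) \<le> n + 1" by simp
  qed (use r in auto)
  then show "int (f_hyp n k r) = \<lfloor>real (n choose r) / real k\<rfloor>"
    by (simp add: q_def floor_divide_of_nat_eq)
qed

end
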